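(* Let $n\ge 1$. The level set of the deformed Hermitian--Yang--Mills equation with phase $\theta$, namely $$\Bigl\{\lambda\in\mathbb{R}^n:\ \sum_{i=1}^n\arctan(\lambda_i)=\theta\Bigr\},$$ is convex if $\theta$ is a supercritical phase, that is, if $\theta\in\bigl((n-2)\tfrac{\pi}{2},\,n\tfrac{\pi}{2}\bigr)$. In addition, the level set is also convex if $\theta\in\bigl(-n\tfrac{\pi}{2},\,-(n-2)\tfrac{\pi}{2}\bigr)$.
   Context: The deformed Hermitian--Yang--Mills equation is $\Im(\omega+\sqrt{-1}\chi)^n=\tan(\theta)\,\Re(\omega+\sqrt{-1}\chi)^n$, where $\omega$ is a Kähler form and $\chi$ a real closed $(1,1)$-form on a complex $n$-dimensional manifold; in terms of the eigenvalues $\lambda_1,\dots,\lambda_n$ of $\omega^{-1}\chi$ at a point it is written as $\sum_i\arctan(\lambda_i)=\theta$, with $\arctan$ taking values in $(-\pi/2,\pi/2)$. Convexity of the level set means that it is the boundary of a closed convex set: for $\theta\in((n-2)\pi/2,n\pi/2)$ the set $\{\sum_i\arctan\lambda_i\ge\theta\}$ is convex, and for $\theta\in(-n\pi/2,-(n-2)\pi/2)$ the set $\{\sum_i\arctan\lambda_i\le\theta\}$ is convex. *)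

theory Defs
  imports "HOL-Analysis.Analysis"
begin

definition lagrangian_phase :: "real ^ 'n \<Rightarrow> real"
  where "lagrangian_phase l = (\<Sum>i\<in>UNIV. arctan (l $ i))"

definition dhym_level_set :: "real \<Rightarrow> (real ^ 'n) set"
  where "dhym_level_set \<theta> = {l. lagrangian_phase l = \<theta>}"

definition dhym_superlevel_set :: "real \<Rightarrow> (real ^ 'n) set"
  where "dhym_superlevel_set \<theta> = {l. \<theta> \<le> lagrangian_phase l}"

definition dhym_sublevel_set :: "real \<Rightarrow> (real ^ 'n) set"
  where "dhym_sublevel_set \<theta> = {l. lagrangian_phase l \<le> \<theta>}"

(* A level set is called convex if it is the boundary of a closed convex set
   (it need not be convex as a set of points). The set C is an argument so that
   it can be named: it is the superlevel set or the sublevel set, depending on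
   the range of the phase. *)
definition convex_level_set_via :: "('a::euclidean_space) set \<Rightarrow> 'a set \<Rightarrow> bool"
  where "convex_level_set_via L C \<longleftrightarrow> closed C \<and> convex C \<and> L = frontier C"

end

theory Submission
  imports Defs
begin

text \<open>
  The complementary angle \<open>arccot x = \<pi> / 2 - arctan x\<close> turns the superlevel set of phase
  \<open>\<theta>\<close> into the set of \<open>l\<close> with \<open>(\<Sum>i. arccot (l $ i)) \<le> n \<pi> / 2 - \<theta>\<close>, and the phase is
  supercritical exactly when the bound on the right lies in \<open>(0, \<pi>)\<close>, the range of \<open>arccot\<close>.
  The bound is thus \<open>arccot a\<close> for some \<open>a\<close>.

  For two angles the addition theorem of the cotangent makes the condition
  \<open>arccot p + arccot q \<le> arccot a\<close> algebraic: it says that \<open>p > a\<close> and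
  \<open>(p - a) (q - a) \<ge> 1 + a\<^sup>2\<close>.
  On positive numbers the geometric mean is concave, and \<open>sqrt (1 + a\<^sup>2)\<close> is a convex
  function of \<open>a\<close>, so the set of all such triples \<open>(p, q, a)\<close> is convex
  (\<open>arccot_add_le_convex\<close>).

  It is essential that \<open>a\<close> varies too, because this makes an induction on the number of angles
  possible (\<open>sum_arccot_le_convex\<close>). The partial sum of all angles but one is itself the
  angle \<open>arccot p\<close> for some \<open>p\<close>. The induction hypothesis controls how \<open>p\<close> varies along
  a segment, and the case of two angles adds the last one. Unlike a computation with the second
  fundamental form of the level set, this needs no separate argument that a segment between two
  points of the set stays in the region where the angles add up to less than \<open>\<pi>\<close>.

  The level set is the frontier of the superlevel set because the phase is continuous and strictly
  increases along the diagonal direction. The second half of the theorem follows by the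
  reflection \<open>l \<mapsto> - l\<close>, as \<open>arctan\<close> is odd.
\<close>

definition arccot :: "real \<Rightarrow> real"
  where "arccot x = pi / 2 - arctan x"

lemma arccot_bounds: "0 < arccot x" "arccot x < pi"
  using arctan_bounded[of x] by (auto simp: arccot_def)

lemma arccot_le_iff [simp]: "arccot x \<le> arccot y \<longleftrightarrow> y \<le> x"
  by (simp add: arccot_def arctan_le_iff)

lemma arccot_surj:
  assumes "0 < b" "b < pi"
  obtains x where "arccot x = b"
proof
  show "arccot (tan (pi / 2 - b)) = b"
    using assms by (simp add: arccot_def arctan_tan)
qed

text \<open>
  The inequality of the angles says that \<open>arccot q\<close> is at most \<open>\<delta> = arccot a - arccot p\<close>.
  This forces \<open>\<delta> > 0\<close>, hence \<open>p > a\<close>, and then amounts to \<open>q \<ge> cot \<delta>\<close>, where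
  \<open>cot \<delta> = (1 + p a) / (p - a)\<close> by the subtraction theorem.
\<close>

lemma arccot_add_le_iff:
  "arccot p + arccot q \<le> arccot a \<longleftrightarrow> a < p \<and> 1 + a\<^sup>2 \<le> (p - a) * (q - a)"
proof (cases "a < p")
  case False
  then have "arccot a \<le> arccot p"
    by simp
  then show ?thesis
    using False arccot_bounds(1)[of q] by linarith
next
  case True
  define \<delta> where "\<delta> = arctan p - arctan a"
  have \<delta>: "0 < \<delta>" "\<delta> < pi"
    using True arctan_bounded[of p] arctan_bounded[of a] by (auto simp: \<delta>_def arctan_less_iff)
  have sq: "sqrt (1 + p\<^sup>2) > 0" "sqrt (1 + a\<^sup>2) > 0"
    by (simp_all add: add_pos_nonneg)
  have "tan (pi / 2 - \<delta>) = cos \<delta> / sin \<delta>"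
    by (simp add: tan_def sin_diff cos_diff)
  also have "cos \<delta> = (1 + p * a) / (sqrt (1 + p\<^sup>2) * sqrt (1 + a\<^sup>2))"
    by (simp add: \<delta>_def cos_diff cos_arctan sin_arctan add_divide_distrib)
  also have "sin \<delta> = (p - a) / (sqrt (1 + p\<^sup>2) * sqrt (1 + a\<^sup>2))"
    by (simp add: \<delta>_def sin_diff cos_arctan sin_arctan diff_divide_distrib)
  finally have tan: "tan (pi / 2 - \<delta>) = (1 + p * a) / (p - a)"
    using sq by simp
  have "arccot p + arccot q \<le> arccot a \<longleftrightarrow> arctan (tan (pi / 2 - \<delta>)) \<le> arctan q"
    using \<delta> by (subst arctan_tan) (auto simp: arccot_def \<delta>_def)
  also have "\<dots> \<longleftrightarrow> (1 + p * a) / (p - a) \<le> q"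
    by (simp add: arctan_le_iff tan)
  also have "\<dots> \<longleftrightarrow> 1 + p * a \<le> q * (p - a)"
    using True by (simp add: pos_divide_le_eq)
  also have "\<dots> \<longleftrightarrow> 1 + a\<^sup>2 \<le> (p - a) * (q - a)"
    by (auto simp: algebra_simps power2_eq_square)
  finally show ?thesis
    using True by simp
qed

text \<open>
  Expanding both sides of the algebraic form and writing \<open>1 = (u + v)\<^sup>2\<close>, the terms in
  \<open>u\<^sup>2\<close> and \<open>v\<^sup>2\<close> are the two hypotheses. The mixed term follows from the inequality of
  the arithmetic and geometric means together with Cauchy-Schwarz for \<open>(1, a)\<close> and \<open>(1, b)\<close>.
\<close>

lemma arccot_add_le_convex:
  assumes "arccot p + arccot q \<le> arccot a" and "arccot p' + arccot q' \<le> arccot b"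
    and uv: "0 \<le> u" "0 \<le> v" "u + v = 1"
  shows "arccot (u * p + v * p') + arccot (u * q + v * q') \<le> arccot (u * a + v * b)"
proof -
  define P Q P' Q' where "P = p - a" and "Q = q - a" and "P' = p' - b" and "Q' = q' - b"
  have PQ: "0 < P" "1 + a\<^sup>2 \<le> P * Q" and PQ': "0 < P'" "1 + b\<^sup>2 \<le> P' * Q'"
    using assms(1,2) by (auto simp: arccot_add_le_iff P_def Q_def P'_def Q'_def)
  have "0 < 1 + a\<^sup>2" "0 < 1 + b\<^sup>2"
    by (simp_all add: add_pos_nonneg)
  then have Q: "0 < Q" "0 < Q'"
    using PQ PQ' by (metis less_le_trans zero_less_mult_pos)+
  have mixed: "2 * (1 + a * b) \<le> P * Q' + P' * Q"
  proof (rule power2_le_imp_le)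
    have "(1 + a * b)\<^sup>2 \<le> (1 + a\<^sup>2) * (1 + b\<^sup>2)"
      using zero_le_power2[of "a - b"] by (simp add: power2_eq_square algebra_simps)
    also have "\<dots> \<le> (P * Q) * (P' * Q')"
      using PQ PQ' Q by (intro mult_mono) auto
    finally show "(2 * (1 + a * b))\<^sup>2 \<le> (P * Q' + P' * Q)\<^sup>2"
      using zero_le_power2[of "P * Q' - P' * Q"] by (simp add: power2_eq_square algebra_simps)
    show "0 \<le> P * Q' + P' * Q"
      using PQ PQ' Q by simp
  qed
  have "1 + (u * a + v * b)\<^sup>2 = (u + v)\<^sup>2 + (u * a + v * b)\<^sup>2"
    using uv by simp
  also have "\<dots> = u\<^sup>2 * (1 + a\<^sup>2) + v\<^sup>2 * (1 + b\<^sup>2) + u * v * (2 * (1 + a * b))"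
    by (simp add: power2_eq_square algebra_simps)
  also have "\<dots> \<le> u\<^sup>2 * (P * Q) + v\<^sup>2 * (P' * Q') + u * v * (P * Q' + P' * Q)"
    using PQ PQ' uv mixed by (intro add_mono mult_left_mono) auto
  also have "\<dots> = (u * P + v * P') * (u * Q + v * Q')"
    by (simp add: power2_eq_square algebra_simps)
  finally have "1 + (u * a + v * b)\<^sup>2 \<le> (u * P + v * P') * (u * Q + v * Q')" .
  moreover have "0 < u * P + v * P'"
    using PQ(1) PQ'(1) uv by (cases "u = 0") (auto intro: add_pos_nonneg)
  ultimately show ?thesis
    by (simp add: arccot_add_le_iff P_def Q_def P'_def Q'_def algebra_simps)
qed

text \<open>
  The bounds \<open>a\<close> and \<open>b\<close> at the two end points differ so that the induction hypothesis can be
  applied with the partial sums of the angles as bounds.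
\<close>

lemma sum_arccot_le_convex:
  assumes "finite A" "A \<noteq> {}"
    and "(\<Sum>i\<in>A. arccot (x i)) \<le> arccot a" and "(\<Sum>i\<in>A. arccot (y i)) \<le> arccot b"
    and uv: "0 \<le> u" "0 \<le> v" "u + v = 1"
  shows "(\<Sum>i\<in>A. arccot (u * x i + v * y i)) \<le> arccot (u * a + v * b)"
  using assms(1-4)
proof (induction A arbitrary: a b rule: finite_ne_induct)
  case (singleton i)
  then show ?case
    using uv by (simp add: add_mono mult_left_mono)
next
  case (insert i A)
  \<comment> \<open>The remaining angle is positive, so the partial sum stays below \<open>\<pi>\<close> and has a cotangent.\<close>
  have partial_sum: "\<exists>p. arccot p = (\<Sum>j\<in>A. arccot (z j))"
    if "(\<Sum>j\<in>insert i A. arccot (z j)) \<le> arccot c" for z c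
  proof -
    have "0 < (\<Sum>j\<in>A. arccot (z j))"
      using insert.hyps by (intro sum_pos arccot_bounds)
    moreover have "(\<Sum>j\<in>A. arccot (z j)) < pi"
      using that insert.hyps arccot_bounds(1)[of "z i"] arccot_bounds(2)[of c] by simp
    ultimately show ?thesis
      by (metis arccot_surj)
  qed
  obtain p where p: "arccot p = (\<Sum>j\<in>A. arccot (x j))"
    using partial_sum insert.prems(1) by blast
  obtain p' where p': "arccot p' = (\<Sum>j\<in>A. arccot (y j))"
    using partial_sum insert.prems(2) by blast
  have "(\<Sum>j\<in>A. arccot (u * x j + v * y j)) \<le> arccot (u * p + v * p')"
    by (rule insert.IH) (simp_all add: p p')
  moreover have "arccot (u * p + v * p') + arccot (u * x i + v * y i) \<le> arccot (u * a + v * b)"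
    using insert.prems insert.hyps uv by (intro arccot_add_le_convex) (simp_all add: p p')
  ultimately show ?case
    using insert.hyps by simp
qed

lemma lagrangian_phase_eq_sum_arccot:
  fixes l :: "real ^ 'n"
  shows "lagrangian_phase l = real CARD('n) * (pi / 2) - (\<Sum>i\<in>UNIV. arccot (l $ i))"
  by (simp add: lagrangian_phase_def arccot_def sum_subtractf)

lemma convex_dhym_superlevel_set:
  assumes "(real CARD('n) - 2) * (pi / 2) < \<theta>" "\<theta> < real CARD('n) * (pi / 2)"
  shows "convex (dhym_superlevel_set \<theta> :: (real ^ 'n) set)"
proof -
  obtain a where a: "arccot a = real CARD('n) * (pi / 2) - \<theta>"
    using assms by (elim arccot_surj[rotated 2]) (auto simp: algebra_simps)
  have mem: "l \<in> dhym_superlevel_set \<theta> \<longleftrightarrow> (\<Sum>i\<in>UNIV. arccot (l $ i)) \<le> arccot a"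
    for l :: "real ^ 'n"
    by (auto simp: dhym_superlevel_set_def lagrangian_phase_eq_sum_arccot a)
  show ?thesis
  proof (rule convexI)
    fix x y :: "real ^ 'n" and u v :: real
    assume "x \<in> dhym_superlevel_set \<theta>" "y \<in> dhym_superlevel_set \<theta>"
      and uv: "0 \<le> u" "0 \<le> v" "u + v = 1"
    then have "(\<Sum>i\<in>UNIV. arccot (u * x $ i + v * y $ i)) \<le> arccot (u * a + v * a)"
      by (intro sum_arccot_le_convex) (simp_all add: mem)
    also have "u * a + v * a = a"
      using uv by (simp flip: distrib_right)
    finally show "u *\<^sub>R x + v *\<^sub>R y \<in> dhym_superlevel_set \<theta>"
      by (simp add: mem)
  qed
qed

lemma continuous_lagrangian_phase: "continuous_on UNIV lagrangian_phase"
  unfolding lagrangian_phase_def[abs_def] by (intro continuous_intros)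

lemma closed_dhym_superlevel_set: "closed (dhym_superlevel_set \<theta>)"
  unfolding dhym_superlevel_set_def
  by (intro closed_Collect_le continuous_intros continuous_lagrangian_phase)

lemma lagrangian_phase_diagonal_less:
  assumes "0 < e"
  shows "lagrangian_phase (l - e *\<^sub>R 1) < lagrangian_phase l"
  unfolding lagrangian_phase_def
  using assms by (intro sum_strict_mono) (simp_all add: arctan_less_iff)

lemma frontier_dhym_superlevel_set:
  "frontier (dhym_superlevel_set \<theta>) = (dhym_level_set \<theta> :: (real ^ 'n) set)"
proof
  let ?C = "dhym_superlevel_set \<theta> :: (real ^ 'n) set"
  have "{l. \<theta> < lagrangian_phase l} \<subseteq> interior ?C"
    by (intro interior_maximal open_Collect_less continuous_intros continuous_lagrangian_phase)
      (auto simp: dhym_superlevel_set_def)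
  moreover have "?C - {l. \<theta> < lagrangian_phase l} = dhym_level_set \<theta>"
    by (auto simp: dhym_superlevel_set_def dhym_level_set_def)
  ultimately show "frontier ?C \<subseteq> dhym_level_set \<theta>"
    unfolding frontier_def closure_closed[OF closed_dhym_superlevel_set] by blast
  show "dhym_level_set \<theta> \<subseteq> frontier ?C"
  proof
    fix l :: "real ^ 'n"
    assume l: "l \<in> dhym_level_set \<theta>"
    \<comment> \<open>Moving from \<open>l\<close> against the diagonal direction leaves the superlevel set at once.\<close>
    have "l \<notin> interior ?C"
    proof
      assume "l \<in> interior ?C"
      moreover have "((\<lambda>e. l - e *\<^sub>R 1) \<longlongrightarrow> l) (at_right 0)"
        by (auto intro!: tendsto_eq_intros)
      ultimately have "eventually (\<lambda>e. l - e *\<^sub>R 1 \<in> interior ?C) (at_right 0)"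
        using topological_tendstoD[OF _ open_interior] by blast
      moreover have "eventually (\<lambda>e::real. 0 < e) (at_right 0)"
        by (rule eventually_at_right_less)
      ultimately have "eventually (\<lambda>e::real. False) (at_right 0)"
      proof eventually_elim
        case (elim e)
        then have "\<theta> \<le> lagrangian_phase (l - e *\<^sub>R 1)"
          using interior_subset by (auto simp: dhym_superlevel_set_def)
        then show False
          using lagrangian_phase_diagonal_less[OF elim(2), of l] l
          by (simp add: dhym_level_set_def)
      qed
      then show False
        by simp
    qed
    then show "l \<in> frontier ?C"
      using l closure_subset[of ?C]
      by (auto simp: frontier_def dhym_superlevel_set_def dhym_level_set_def)
  qed
qed

lemma convex_level_set_via_dhym_superlevel_set:
  assumes "(real CARD('n) - 2) * (pi / 2) < \<theta>" "\<theta> < real CARD('n) * (pi / 2)"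
  shows "convex_level_set_via (dhym_level_set \<theta> :: (real ^ 'n) set) (dhym_superlevel_set \<theta>)"
  unfolding convex_level_set_via_def
  by (simp add: closed_dhym_superlevel_set convex_dhym_superlevel_set[OF assms]
      frontier_dhym_superlevel_set)

lemma lagrangian_phase_minus: "lagrangian_phase (- l) = - lagrangian_phase l"
  by (simp add: lagrangian_phase_def arctan_minus sum_negf)

lemma mem_uminus_image: "x \<in> uminus ` S \<longleftrightarrow> - x \<in> S"
  for x :: "'a::group_add"
  by (metis image_iff minus_minus)

lemma dhym_level_set_eq_reflection: "dhym_level_set \<theta> = uminus ` dhym_level_set (- \<theta>)"
  by (rule set_eqI) (simp add: dhym_level_set_def lagrangian_phase_minus mem_uminus_image)

lemma dhym_sublevel_set_eq_reflection:
  "dhym_sublevel_set \<theta> = uminus ` dhym_superlevel_set (- \<theta>)"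
  by (rule set_eqI)
    (simp add: dhym_sublevel_set_def dhym_superlevel_set_def lagrangian_phase_minus mem_uminus_image)

lemma convex_level_set_via_reflection:
  assumes "convex_level_set_via L C"
  shows "convex_level_set_via (uminus ` L) (uminus ` C)"
proof -
  have C: "closed C" "convex C" "L = frontier C"
    using assms by (simp_all add: convex_level_set_via_def)
  have "frontier (uminus ` C) = uminus ` frontier C"
    using C(1)
    by (simp add: frontier_def closed_negations interior_negations image_set_diff)
  then show ?thesis
    using C by (simp add: convex_level_set_via_def closed_negations convex_negations)
qed

theorem lemma4p2:
  fixes \<theta> :: real
  shows "(\<theta> \<in> {(real CARD('n::finite) - 2) * (pi / 2) <..< real CARD('n) * (pi / 2)} \<longrightarrow>
            convex_level_set_via (dhym_level_set \<theta> :: (real ^ 'n) set) (dhym_superlevel_set \<theta>)) \<and>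
         (\<theta> \<in> {- real CARD('n) * (pi / 2) <..< - (real CARD('n) - 2) * (pi / 2)} \<longrightarrow>
            convex_level_set_via (dhym_level_set \<theta> :: (real ^ 'n) set) (dhym_sublevel_set \<theta>))"
proof (intro conjI impI)
  assume "\<theta> \<in> {(real CARD('n) - 2) * (pi / 2) <..< real CARD('n) * (pi / 2)}"
  then show "convex_level_set_via (dhym_level_set \<theta> :: (real ^ 'n) set) (dhym_superlevel_set \<theta>)"
    by (intro convex_level_set_via_dhym_superlevel_set) auto
next
  assume "\<theta> \<in> {- real CARD('n) * (pi / 2) <..< - (real CARD('n) - 2) * (pi / 2)}"
  then have "convex_level_set_via (dhym_level_set (- \<theta>) :: (real ^ 'n) set)
      (dhym_superlevel_set (- \<theta>))"
    by (intro convex_level_set_via_dhym_superlevel_set) (auto simp: algebra_simps)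
  then show "convex_level_set_via (dhym_level_set \<theta> :: (real ^ 'n) set) (dhym_sublevel_set \<theta>)"
    unfolding dhym_level_set_eq_reflection[of \<theta>] dhym_sublevel_set_eq_reflection[of \<theta>]
    by (rule convex_level_set_via_reflection)
qed

end
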